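(* Let $(Y,M,N,*,\diamond)$ be an intuitionistic fuzzy metric space and let $X\subseteq Y$ be a subspace which, with the subspace topology inherited from $\tau_{(M,N)}$, is a topologically complete intuitionistic fuzzy metrizable space. Then $X$ is a $G_\delta$ subset of $Y$.
   Context: A continuous t-norm is a binary operation $*:[0,1]\times[0,1]\to[0,1]$ that is associative, commutative, continuous, satisfies $a*1=a$ for all $a\in[0,1]$, and satisfies $a*b\le c*d$ whenever $a\le c$ and $b\le d$. A continuous t-conorm is a binary operation $\diamond:[0,1]\times[0,1]\to[0,1]$ that is associative, commutative, continuous, satisfies $a\diamond 0=a$ for all $a\in[0,1]$, and satisfies $a\diamond b\le c\diamond d$ whenever $a\le c$ and $b\le d$. An intuitionistic fuzzy metric space is a 5-tuple $(X,M,N,*,\diamond)$ where $X$ is a non-empty set, $*$ is a continuous t-norm, $\diamond$ is a continuous t-conorm, and $M,N:X\times X\times(0,\infty)\to[0,1]$ satisfy, for all $x,y,z\in X$ and $t,s>0$: (a) $M(x,y,t)+N(x,y,t)\le 1$; (b) $M(x,y,t)>0$; (c) $M(x,y,t)=1$ if and only if $x=y$; (d) $M(x,y,t)=M(y,x,t)$; (e) $M(x,y,t)*M(y,z,s)\le M(x,z,t+s)$; (f) $M(x,y,\cdot):(0,\infty)\to[0,1]$ is continuous; (g) $N(x,y,t)<1$; (h) $N(x,y,t)=0$ if and only if $x=y$; (i) $N(x,y,t)=N(y,x,t)$; (j) $N(x,y,t)\diamond N(y,z,s)\ge N(x,z,t+s)$; (k) $N(x,y,\cdot):(0,\infty)\to[0,1]$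 is continuous. Then $(M,N)$ is called an intuitionistic fuzzy metric on $X$. For $x\in X$, $0<r<1$, $t>0$, put $B(x,r,t)=\{y\in X: M(x,y,t)>1-r,\ N(x,y,t)<r\}$. The topology $\tau_{(M,N)}$ induced by $(M,N)$ consists of all $U\subseteq X$ such that for each $x\in U$ there exist $t>0$ and $0<r<1$ with $B(x,r,t)\subseteq U$. A sequence $\{x_n\}$ converges to $x$ if and only if $M(x_n,x,t)\to1$ and $N(x_n,x,t)\to0$ for each $t>0$. It is Cauchy if for each $0<\varepsilon<1$ and $t>0$ there is $n_0\in\mathbb{N}$ with $M(x_n,x_m,t)>1-\varepsilon$ and $N(x_n,x_m,t)<\varepsilon$ for all $n,m\ge n_0$. The space (and the intuitionistic fuzzy metric) is complete if every Cauchy sequence converges in it. A topological space is a topologically complete intuitionistic fuzzy metrizable space if there exists a complete intuitionistic fuzzy metric (with some continuous t-norm and t-conorm) inducing its topology. A $G_\delta$ set is a countable intersection of open sets. *)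

theory Defs
  imports "HOL-Analysis.Analysis"
begin

text \<open>Operations on the unit interval are total functions on the reals of which only the
  restriction to \<open>{0..1}\<close> is constrained; similarly the functions \<open>M x y\<close> and \<open>N x y\<close> below
  matter only for \<open>x\<close>, \<open>y\<close> in the carrier and positive third argument.\<close>

locale continuous_t_norm =
  fixes T :: "real \<Rightarrow> real \<Rightarrow> real"
  assumes tnorm_closed: "\<lbrakk>a \<in> {0..1}; b \<in> {0..1}\<rbrakk> \<Longrightarrow> T a b \<in> {0..1}"
    and tnorm_assoc: "\<lbrakk>a \<in> {0..1}; b \<in> {0..1}; c \<in> {0..1}\<rbrakk> \<Longrightarrow> T (T a b) c = T a (T b c)"
    and tnorm_commute: "\<lbrakk>a \<in> {0..1}; b \<in> {0..1}\<rbrakk> \<Longrightarrow> T a b = T b a"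
    and tnorm_continuous: "continuous_on ({0..1} \<times> {0..1}) (\<lambda>(a, b). T a b)"
    and tnorm_unit: "a \<in> {0..1} \<Longrightarrow> T a 1 = a"
    and tnorm_mono: "\<lbrakk>a \<in> {0..1}; b \<in> {0..1}; c \<in> {0..1}; d \<in> {0..1}; a \<le> c; b \<le> d\<rbrakk>
          \<Longrightarrow> T a b \<le> T c d"

locale continuous_t_conorm =
  fixes S :: "real \<Rightarrow> real \<Rightarrow> real"
  assumes tconorm_closed: "\<lbrakk>a \<in> {0..1}; b \<in> {0..1}\<rbrakk> \<Longrightarrow> S a b \<in> {0..1}"
    and tconorm_assoc: "\<lbrakk>a \<in> {0..1}; b \<in> {0..1}; c \<in> {0..1}\<rbrakk> \<Longrightarrow> S (S a b) c = S a (S b c)"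
    and tconorm_commute: "\<lbrakk>a \<in> {0..1}; b \<in> {0..1}\<rbrakk> \<Longrightarrow> S a b = S b a"
    and tconorm_continuous: "continuous_on ({0..1} \<times> {0..1}) (\<lambda>(a, b). S a b)"
    and tconorm_unit: "a \<in> {0..1} \<Longrightarrow> S a 0 = a"
    and tconorm_mono: "\<lbrakk>a \<in> {0..1}; b \<in> {0..1}; c \<in> {0..1}; d \<in> {0..1}; a \<le> c; b \<le> d\<rbrakk>
          \<Longrightarrow> S a b \<le> S c d"

locale ifm_space = continuous_t_norm T + continuous_t_conorm S
  for X :: "'a set"
    and M N :: "'a \<Rightarrow> 'a \<Rightarrow> real \<Rightarrow> real"
    and T S :: "real \<Rightarrow> real \<Rightarrow> real" +
  assumes nonempty: "X \<noteq> {}"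
    and M_range: "\<lbrakk>x \<in> X; y \<in> X; t > 0\<rbrakk> \<Longrightarrow> M x y t \<in> {0..1}"
    and N_range: "\<lbrakk>x \<in> X; y \<in> X; t > 0\<rbrakk> \<Longrightarrow> N x y t \<in> {0..1}"
    and M_N_le_1: "\<lbrakk>x \<in> X; y \<in> X; t > 0\<rbrakk> \<Longrightarrow> M x y t + N x y t \<le> 1"
    and M_pos: "\<lbrakk>x \<in> X; y \<in> X; t > 0\<rbrakk> \<Longrightarrow> M x y t > 0"
    and M_eq_1_iff: "\<lbrakk>x \<in> X; y \<in> X; t > 0\<rbrakk> \<Longrightarrow> M x y t = 1 \<longleftrightarrow> x = y"
    and M_commute: "\<lbrakk>x \<in> X; y \<in> X; t > 0\<rbrakk> \<Longrightarrow> M x y t = M y x t"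
    and M_triangle: "\<lbrakk>x \<in> X; y \<in> X; z \<in> X; t > 0; s > 0\<rbrakk>
          \<Longrightarrow> T (M x y t) (M y z s) \<le> M x z (t + s)"
    and M_continuous: "\<lbrakk>x \<in> X; y \<in> X\<rbrakk> \<Longrightarrow> continuous_on {0<..} (M x y)"
    and N_less_1: "\<lbrakk>x \<in> X; y \<in> X; t > 0\<rbrakk> \<Longrightarrow> N x y t < 1"
    and N_eq_0_iff: "\<lbrakk>x \<in> X; y \<in> X; t > 0\<rbrakk> \<Longrightarrow> N x y t = 0 \<longleftrightarrow> x = y"
    and N_commute: "\<lbrakk>x \<in> X; y \<in> X; t > 0\<rbrakk> \<Longrightarrow> N x y t = N y x t"
    and N_triangle: "\<lbrakk>x \<in> X; y \<in> X; z \<in> X; t > 0; s > 0\<rbrakk>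
          \<Longrightarrow> S (N x y t) (N y z s) \<ge> N x z (t + s)"
    and N_continuous: "\<lbrakk>x \<in> X; y \<in> X\<rbrakk> \<Longrightarrow> continuous_on {0<..} (N x y)"

definition ifm_ball ::
  "'a set \<Rightarrow> ('a \<Rightarrow> 'a \<Rightarrow> real \<Rightarrow> real) \<Rightarrow> ('a \<Rightarrow> 'a \<Rightarrow> real \<Rightarrow> real) \<Rightarrow> 'a \<Rightarrow> real \<Rightarrow> real \<Rightarrow> 'a set"
  where "ifm_ball X M N x r t = {y \<in> X. M x y t > 1 - r \<and> N x y t < r}"

definition ifm_open ::
  "'a set \<Rightarrow> ('a \<Rightarrow> 'a \<Rightarrow> real \<Rightarrow> real) \<Rightarrow> ('a \<Rightarrow> 'a \<Rightarrow> real \<Rightarrow> real) \<Rightarrow> 'a set \<Rightarrow> bool"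
  where "ifm_open X M N U \<longleftrightarrow>
    U \<subseteq> X \<and> (\<forall>x\<in>U. \<exists>t r. t > 0 \<and> 0 < r \<and> r < 1 \<and> ifm_ball X M N x r t \<subseteq> U)"

text \<open>The library constructor \<^const>\<open>topology\<close> is meaningful only for predicates satisfying
  \<^const>\<open>istopology\<close>; this is established for intuitionistic fuzzy metric spaces below.\<close>

definition ifm_topology ::
  "'a set \<Rightarrow> ('a \<Rightarrow> 'a \<Rightarrow> real \<Rightarrow> real) \<Rightarrow> ('a \<Rightarrow> 'a \<Rightarrow> real \<Rightarrow> real) \<Rightarrow> 'a topology"
  where "ifm_topology X M N = topology (ifm_open X M N)"

definition ifm_converges ::
  "('a \<Rightarrow> 'a \<Rightarrow> real \<Rightarrow> real) \<Rightarrow> ('a \<Rightarrow> 'a \<Rightarrow> real \<Rightarrow> real) \<Rightarrow> (nat \<Rightarrow> 'a) \<Rightarrow> 'a \<Rightarrow> bool"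
  where "ifm_converges M N \<sigma> x \<longleftrightarrow>
    (\<forall>t>0. (\<lambda>n. M (\<sigma> n) x t) \<longlonglongrightarrow> 1 \<and> (\<lambda>n. N (\<sigma> n) x t) \<longlonglongrightarrow> 0)"

definition ifm_Cauchy ::
  "('a \<Rightarrow> 'a \<Rightarrow> real \<Rightarrow> real) \<Rightarrow> ('a \<Rightarrow> 'a \<Rightarrow> real \<Rightarrow> real) \<Rightarrow> (nat \<Rightarrow> 'a) \<Rightarrow> bool"
  where "ifm_Cauchy M N \<sigma> \<longleftrightarrow>
    (\<forall>\<epsilon> t. 0 < \<epsilon> \<and> \<epsilon> < 1 \<and> t > 0 \<longrightarrow>
      (\<exists>n0. \<forall>n\<ge>n0. \<forall>m\<ge>n0. M (\<sigma> n) (\<sigma> m) t > 1 - \<epsilon> \<and> N (\<sigma> n) (\<sigma> m) t < \<epsilon>))"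

definition ifm_complete ::
  "'a set \<Rightarrow> ('a \<Rightarrow> 'a \<Rightarrow> real \<Rightarrow> real) \<Rightarrow> ('a \<Rightarrow> 'a \<Rightarrow> real \<Rightarrow> real) \<Rightarrow> bool"
  where "ifm_complete X M N \<longleftrightarrow>
    (\<forall>\<sigma>. range \<sigma> \<subseteq> X \<and> ifm_Cauchy M N \<sigma> \<longrightarrow> (\<exists>x\<in>X. ifm_converges M N \<sigma> x))"

definition topologically_complete_ifm_metrizable :: "'a topology \<Rightarrow> bool"
  where "topologically_complete_ifm_metrizable \<tau> \<longleftrightarrow>
    (\<exists>M N T S. ifm_space (topspace \<tau>) M N T S \<and> ifm_complete (topspace \<tau>) M N
      \<and> ifm_topology (topspace \<tau>) M N = \<tau>)"

context ifm_space
begin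

lemma M_mono:
  assumes "x \<in> X" "y \<in> X" "0 < t" "t \<le> t'"
  shows "M x y t \<le> M x y t'"
proof (cases "t = t'")
  case False
  then have "T (M x y t) (M y y (t' - t)) \<le> M x y (t + (t' - t))"
    using assms by (intro M_triangle) auto
  moreover have "M y y (t' - t) = 1"
    using M_eq_1_iff[of y y "t' - t"] assms False by auto
  ultimately show ?thesis
    using tnorm_unit[OF M_range[of x y t]] assms by simp
qed simp

lemma N_antimono:
  assumes "x \<in> X" "y \<in> X" "0 < t" "t \<le> t'"
  shows "N x y t' \<le> N x y t"
proof (cases "t = t'")
  case False
  then have "S (N x y t) (N y y (t' - t)) \<ge> N x y (t + (t' - t))"
    using assms by (intro N_triangle) auto
  moreover have "N y y (t' - t) = 0"
    using N_eq_0_iff[of y y "t' - t"] assms False by auto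
  ultimately show ?thesis
    using tconorm_unit[OF N_range[of x y t]] assms by simp
qed simp

lemma ifm_ball_mono:
  assumes "x \<in> X" "r \<le> r'" "0 < t" "t \<le> t'"
  shows "ifm_ball X M N x r t \<subseteq> ifm_ball X M N x r' t'"
proof
  fix y assume "y \<in> ifm_ball X M N x r t"
  then show "y \<in> ifm_ball X M N x r' t'"
    using M_mono[of x y t t'] N_antimono[of x y t t'] assms unfolding ifm_ball_def by auto
qed

lemma istopology_ifm_open: "istopology (ifm_open X M N)"
  unfolding istopology_def
proof (intro conjI allI impI)
  fix U V assume U: "ifm_open X M N U" and V: "ifm_open X M N V"
  have "\<exists>t r. t > 0 \<and> 0 < r \<and> r < 1 \<and> ifm_ball X M N x r t \<subseteq> U \<inter> V" if x: "x \<in> U \<inter> V" for x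
  proof -
    obtain t1 r1 where 1: "t1 > 0" "0 < r1" "r1 < 1" "ifm_ball X M N x r1 t1 \<subseteq> U"
      using U x unfolding ifm_open_def by blast
    obtain t2 r2 where 2: "t2 > 0" "0 < r2" "r2 < 1" "ifm_ball X M N x r2 t2 \<subseteq> V"
      using V x unfolding ifm_open_def by blast
    have "x \<in> X" using U x unfolding ifm_open_def by blast
    then have "ifm_ball X M N x (min r1 r2) (min t1 t2) \<subseteq> U \<inter> V"
      using ifm_ball_mono[of x "min r1 r2" r1 "min t1 t2" t1]
        ifm_ball_mono[of x "min r1 r2" r2 "min t1 t2" t2] 1 2 by auto
    then show ?thesis
      using 1 2 by (intro exI[of _ "min t1 t2"] exI[of _ "min r1 r2"]) auto
  qed
  then show "ifm_open X M N (U \<inter> V)"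
    using U unfolding ifm_open_def by blast
next
  fix \<U> assume "\<forall>U\<in>\<U>. ifm_open X M N U"
  then show "ifm_open X M N (\<Union> \<U>)"
    unfolding ifm_open_def by (meson Sup_least UnionE Union_upper order_trans)
qed

lemma openin_ifm_topology: "openin (ifm_topology X M N) U \<longleftrightarrow> ifm_open X M N U"
  by (simp add: ifm_topology_def istopology_ifm_open topology_inverse')

lemma topspace_ifm_topology: "topspace (ifm_topology X M N) = X"
proof -
  have "ifm_open X M N X"
    unfolding ifm_open_def ifm_ball_def
    by (auto intro!: exI[of _ "1::real"] exI[of _ "1/2::real"])
  then show ?thesis
    unfolding topspace_def openin_ifm_topology by (auto simp: ifm_open_def)
qed

end

end

theory Submission
  imports Defs
begin

text \<open>The set \<open>X\<close> is the intersection of the open sets \<open>W n\<close> covered by those open sets \<open>U\<close> of \<open>Y\<close>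
  for which some centre \<open>x \<in> X\<close> has \<open>U\<close> inside its \<open>1/(n+2)\<close>-ball in \<open>Y\<close> and \<open>U \<inter> X\<close> inside
  its \<open>1/(n+2)\<close>-ball for the complete intuitionistic fuzzy metric of \<open>X\<close>. If \<open>y\<close> lies in all
  \<open>W n\<close>, the corresponding centres converge to \<open>y\<close> in \<open>Y\<close>, hence eventually enter each of the
  chosen open sets, hence are Cauchy for the complete metric. They converge in \<open>X\<close>, and uniqueness
  of limits in \<open>Y\<close> gives \<open>y \<in> X\<close>.\<close>

text \<open>Continuity of \<open>T\<close> is given on the closed unit square only, so composing
  limits requires both arguments to stay in \<open>{0..1}\<close> eventually.\<close>

lemma (in continuous_t_norm) tendsto_tnorm:
  assumes "(f \<longlongrightarrow> a) F" "(g \<longlongrightarrow> b) F" "a \<in> {0..1}" "b \<in> {0..1}"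
    and "\<forall>\<^sub>F x in F. f x \<in> {0..1}" "\<forall>\<^sub>F x in F. g x \<in> {0..1}"
  shows "((\<lambda>x. T (f x) (g x)) \<longlongrightarrow> T a b) F"
proof -
  have "((\<lambda>x. (\<lambda>(a, b). T a b) (f x, g x)) \<longlongrightarrow> (\<lambda>(a, b). T a b) (a, b)) F"
    using assms(3-) by (intro continuous_on_tendsto_compose[OF tnorm_continuous] tendsto_Pair
        assms(1,2)) (auto elim: eventually_elim2)
  then show ?thesis by simp
qed

lemma (in continuous_t_conorm) tendsto_tconorm:
  assumes "(f \<longlongrightarrow> a) F" "(g \<longlongrightarrow> b) F" "a \<in> {0..1}" "b \<in> {0..1}"
    and "\<forall>\<^sub>F x in F. f x \<in> {0..1}" "\<forall>\<^sub>F x in F. g x \<in> {0..1}"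
  shows "((\<lambda>x. S (f x) (g x)) \<longlongrightarrow> S a b) F"
proof -
  have "((\<lambda>x. (\<lambda>(a, b). S a b) (f x, g x)) \<longlongrightarrow> (\<lambda>(a, b). S a b) (a, b)) F"
    using assms(3-) by (intro continuous_on_tendsto_compose[OF tconorm_continuous] tendsto_Pair
        assms(1,2)) (auto elim: eventually_elim2)
  then show ?thesis by simp
qed

context ifm_space
begin

lemma center_in_ifm_ball: "\<lbrakk>x \<in> X; 0 < r; 0 < t\<rbrakk> \<Longrightarrow> x \<in> ifm_ball X M N x r t"
  using M_eq_1_iff[of x x t] N_eq_0_iff[of x x t] by (auto simp: ifm_ball_def)

text \<open>The strict inequalities at time \<open>t\<close> leave slack: continuity in time keeps
  them at some \<open>s < t\<close>, and continuity of \<open>T\<close> and \<open>S\<close> at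
  their units keeps them after combination with a small error \<open>d\<close>. The triangle
  inequalities for t = s + (t - s) then place the \<open>d\<close>-ball around \<open>y\<close> at
  time \<open>t - s\<close> inside the given ball.\<close>

lemma ifm_open_ball:
  assumes x: "x \<in> X" and t: "0 < t"
  shows "ifm_open X M N (ifm_ball X M N x r t)"
  unfolding ifm_open_def
proof (intro conjI ballI)
  show "ifm_ball X M N x r t \<subseteq> X" by (auto simp: ifm_ball_def)
next
  fix y assume "y \<in> ifm_ball X M N x r t"
  then have y: "y \<in> X" and My: "M x y t > 1 - r" and Ny: "N x y t < r"
    by (auto simp: ifm_ball_def)
  have "(M x y \<longlongrightarrow> M x y t) (at t)" "(N x y \<longlongrightarrow> N x y t) (at t)"
    using M_continuous[OF x y] N_continuous[OF x y] t
    by (auto simp: continuous_on_eq_continuous_at isCont_def)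
  \<comment> \<open>Left limits are taken so that \<open>s\<close> falls strictly below
    \<open>t\<close>, leaving a positive time \<open>t - s\<close>.\<close>
  then have lim: "(M x y \<longlongrightarrow> M x y t) (at_left t)" "(N x y \<longlongrightarrow> N x y t) (at_left t)"
    by (auto simp: filterlim_at_split)
  have "\<forall>\<^sub>F s in at_left t. M x y s > 1 - r" "\<forall>\<^sub>F s in at_left t. N x y s < r"
    using order_tendstoD(1)[OF lim(1) My] order_tendstoD(2)[OF lim(2) Ny] .
  moreover have "\<forall>\<^sub>F s in at_left t. s \<in> {0<..<t}"
    by (rule eventually_at_left_real) (rule t)
  ultimately have "\<forall>\<^sub>F s in at_left t. M x y s > 1 - r \<and> N x y s < r \<and> 0 < s \<and> s < t"
    by eventually_elim auto
  then obtain s where s: "M x y s > 1 - r" "N x y s < r" "0 < s" "s < t"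
    by (auto dest!: eventually_happens'[OF trivial_limit_at_left_real])
  have range: "M x y s \<in> {0..1}" "N x y s \<in> {0..1}"
    using M_range N_range x y s by blast+
  have d: "\<forall>\<^sub>F d in at_right 0. d \<in> {0<..<(1::real)}"
    by (rule eventually_at_right_real) simp
  \<comment> \<open>As \<open>d\<close> decreases to 0, the second arguments tend to the units 1 and
    0, so the two limits are \<open>M x y s\<close> and \<open>N x y s\<close>.\<close>
  have "((\<lambda>d. T (M x y s) (1 - d)) \<longlongrightarrow> T (M x y s) 1) (at_right 0)"
    by (rule tendsto_tnorm) (use range d in \<open>auto intro!: tendsto_eq_intros elim: eventually_mono\<close>)
  moreover have "((\<lambda>d. S (N x y s) d) \<longlongrightarrow> S (N x y s) 0) (at_right 0)"
    by (rule tendsto_tconorm) (use range d in \<open>auto intro!: tendsto_eq_intros elim: eventually_mono\<close>)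
  ultimately have "\<forall>\<^sub>F d in at_right 0.
      T (M x y s) (1 - d) > 1 - r \<and> S (N x y s) d < r \<and> d \<in> {0<..<1}"
    using s range d by (intro eventually_conj order_tendstoD) (auto simp: tnorm_unit tconorm_unit)
  then obtain d where d: "T (M x y s) (1 - d) > 1 - r" "S (N x y s) d < r" "0 < d" "d < 1"
    by (auto dest!: eventually_happens'[OF trivial_limit_at_right_real])
  have "ifm_ball X M N y d (t - s) \<subseteq> ifm_ball X M N x r t"
  proof
    fix z assume "z \<in> ifm_ball X M N y d (t - s)"
    then have z: "z \<in> X" "M y z (t - s) > 1 - d" "N y z (t - s) < d"
      by (auto simp: ifm_ball_def)
    have yz: "M y z (t - s) \<in> {0..1}" "N y z (t - s) \<in> {0..1}"
      using M_range N_range y z s by auto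
    have "T (M x y s) (1 - d) \<le> T (M x y s) (M y z (t - s))"
      using range yz z d by (intro tnorm_mono) auto
    also have "\<dots> \<le> M x z t"
      using M_triangle[of x y z s "t - s"] x y z s by simp
    finally have "M x z t > 1 - r" using d by simp
    moreover have "N x z t \<le> S (N x y s) (N y z (t - s))"
      using N_triangle[of x y z s "t - s"] x y z s by simp
    moreover have "S (N x y s) (N y z (t - s)) \<le> S (N x y s) d"
      using range yz z d by (intro tconorm_mono) auto
    ultimately show "z \<in> ifm_ball X M N x r t"
      using z d by (simp add: ifm_ball_def)
  qed
  then show "\<exists>t' d. t' > 0 \<and> 0 < d \<and> d < 1 \<and> ifm_ball X M N y d t' \<subseteq> ifm_ball X M N x r t"
    using s d by (intro exI[of _ "t - s"] exI[of _ d]) auto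
qed

text \<open>This makes convergence a property of the topology alone, so that it can be carried from
  one fuzzy metric to another. Balls are open neighbourhoods of their centre, and every open set
  around \<open>x\<close> contains a ball at \<open>x\<close>.\<close>

lemma limitin_ifm_topology_iff:
  assumes \<sigma>: "range \<sigma> \<subseteq> X" and x: "x \<in> X"
  shows "limitin (ifm_topology X M N) \<sigma> x sequentially \<longleftrightarrow> ifm_converges M N \<sigma> x"
proof
  assume L: "limitin (ifm_topology X M N) \<sigma> x sequentially"
  have ball: "\<forall>\<^sub>F n in sequentially. \<sigma> n \<in> ifm_ball X M N x r t" if "0 < r" "0 < t" for r t
    using L ifm_open_ball[OF x] center_in_ifm_ball[OF x] that
    by (auto simp: limitin_def openin_ifm_topology)
  have bound: "0 \<le> M (\<sigma> n) x t" "M (\<sigma> n) x t \<le> 1" "0 \<le> N (\<sigma> n) x t" if "0 < t" for n t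
    using M_range[of "\<sigma> n" x t] N_range[of "\<sigma> n" x t] \<sigma> x that by auto
  show "ifm_converges M N \<sigma> x"
    unfolding ifm_converges_def tendsto_iff
  proof (intro allI impI conjI)
    fix t e :: real assume "0 < t" "0 < e"
    \<comment> \<open>The tolerance \<open>e\<close> itself is the radius; it may exceed 1, as
      \<open>ball\<close> holds for every positive radius.\<close>
    note ev = ball[OF \<open>0 < e\<close> \<open>0 < t\<close>]
    have eq: "M x (\<sigma> n) t = M (\<sigma> n) x t" "N x (\<sigma> n) t = N (\<sigma> n) x t" for n
      using M_commute[of x "\<sigma> n" t] N_commute[of x "\<sigma> n" t] \<sigma> x \<open>0 < t\<close> by auto
    show "\<forall>\<^sub>F n in sequentially. dist (M (\<sigma> n) x t) 1 < e"
      using ev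
    proof eventually_elim
      case (elim n)
      then show ?case
        using bound(2)[OF \<open>0 < t\<close>, of n] by (simp add: ifm_ball_def eq dist_real_def)
    qed
    show "\<forall>\<^sub>F n in sequentially. dist (N (\<sigma> n) x t) 0 < e"
      using ev by eventually_elim
        (use bound[OF \<open>0 < t\<close>] in \<open>auto simp: ifm_ball_def eq\<close>)
  qed
next
  assume C: "ifm_converges M N \<sigma> x"
  show "limitin (ifm_topology X M N) \<sigma> x sequentially"
    unfolding limitin_def
  proof (intro conjI allI impI)
    fix U assume "openin (ifm_topology X M N) U \<and> x \<in> U"
    then obtain t r where t: "t > 0" and r: "0 < r" and U: "ifm_ball X M N x r t \<subseteq> U"
      unfolding openin_ifm_topology ifm_open_def by blast
    have lim: "(\<lambda>n. M (\<sigma> n) x t) \<longlonglongrightarrow> 1" "(\<lambda>n. N (\<sigma> n) x t) \<longlonglongrightarrow> 0"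
      using C t by (auto simp: ifm_converges_def)
    have "\<forall>\<^sub>F n in sequentially. 1 - r < M (\<sigma> n) x t" "\<forall>\<^sub>F n in sequentially. N (\<sigma> n) x t < r"
      using order_tendstoD[OF lim(1)] order_tendstoD[OF lim(2)] r by auto
    then show "\<forall>\<^sub>F n in sequentially. \<sigma> n \<in> U"
    proof eventually_elim
      case (elim n)
      have "\<sigma> n \<in> X" using \<sigma> by auto
      with elim have "\<sigma> n \<in> ifm_ball X M N x r t"
        using M_commute[of "\<sigma> n" x t] N_commute[of "\<sigma> n" x t] x t by (auto simp: ifm_ball_def)
      then show ?case using U by blast
    qed
  qed (use x in \<open>simp add: topspace_ifm_topology\<close>)
qed

text \<open>The triangle inequality through \<open>\<sigma> n\<close> bounds \<open>M x y 2\<close>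
  below by values tending to \<open>T 1 1\<close>, which is 1.\<close>

lemma ifm_converges_unique:
  assumes \<sigma>: "range \<sigma> \<subseteq> X" and x: "x \<in> X" and y: "y \<in> X"
    and "ifm_converges M N \<sigma> x" "ifm_converges M N \<sigma> y"
  shows "x = y"
proof -
  have \<sigma>X: "\<sigma> n \<in> X" for n using \<sigma> by auto
  have "(\<lambda>n. M x (\<sigma> n) 1) \<longlonglongrightarrow> 1" "(\<lambda>n. M (\<sigma> n) y 1) \<longlonglongrightarrow> 1"
    using assms(4,5) M_commute[OF x \<sigma>X] by (auto simp: ifm_converges_def)
  then have "(\<lambda>n. T (M x (\<sigma> n) 1) (M (\<sigma> n) y 1)) \<longlonglongrightarrow> T 1 1"
    by (rule tendsto_tnorm)
      (use M_range[OF x \<sigma>X] M_range[OF \<sigma>X y] in \<open>auto intro!: always_eventually\<close>)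
  moreover have "T (M x (\<sigma> n) 1) (M (\<sigma> n) y 1) \<le> M x y (1 + 1)" for n
    using x \<sigma>X y by (intro M_triangle) auto
  ultimately have "T 1 1 \<le> M x y (1 + 1)"
    by (intro LIMSEQ_le_const2) auto
  then show ?thesis
    using M_range[OF x y, of 2] M_eq_1_iff[OF x y, of 2] by (simp add: tnorm_unit)
qed

text \<open>Late terms share the ball around \<open>c k\<close>, so the triangle inequality through
  \<open>c k\<close> compares any two of them at time \<open>r k + r k\<close>. A single
  sufficiently large \<open>k\<close> suffices for given \<open>\<epsilon>\<close> and
  \<open>t\<close>.\<close>

lemma ifm_Cauchy_if_eventually_in_balls:
  assumes \<sigma>: "range \<sigma> \<subseteq> X" and r: "r \<longlonglongrightarrow> 0" "\<And>k. r k \<in> {0<..<1}"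
    and c: "\<And>k. c k \<in> X" and ev: "\<And>k. \<forall>\<^sub>F n in sequentially. \<sigma> n \<in> ifm_ball X M N (c k) (r k) (r k)"
  shows "ifm_Cauchy M N \<sigma>"
  unfolding ifm_Cauchy_def
proof (intro allI impI, elim conjE)
  fix \<epsilon> t :: real assume \<epsilon>: "0 < \<epsilon>" "\<epsilon> < 1" and t: "0 < t"
  have r01: "0 < r k" "r k < 1" for k using r(2)[of k] by auto
  have r01': "r k \<in> {0..1}" "1 - r k \<in> {0..1}" for k using r01[of k] by auto
  have "(\<lambda>k. T (1 - r k) (1 - r k)) \<longlonglongrightarrow> T 1 1"
    by (rule tendsto_tnorm) (use r01' r(1) in \<open>auto intro!: tendsto_eq_intros always_eventually\<close>)
  moreover have "(\<lambda>k. S (r k) (r k)) \<longlonglongrightarrow> S 0 0"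
    by (rule tendsto_tconorm) (use r01' r(1) in \<open>auto intro!: always_eventually\<close>)
  moreover have "(\<lambda>k. r k + r k) \<longlonglongrightarrow> 0"
    using tendsto_add[OF r(1) r(1)] by simp
  \<comment> \<open>The bounds passing through the centre tend to 1 and 0 and the time used tends to
    0, so one \<open>k\<close> meets all three demands.\<close>
  ultimately have "\<forall>\<^sub>F k in sequentially.
      T (1 - r k) (1 - r k) > 1 - \<epsilon> \<and> S (r k) (r k) < \<epsilon> \<and> r k + r k < t"
    using \<epsilon> t by (intro eventually_conj order_tendstoD) (auto simp: tnorm_unit tconorm_unit)
  then obtain k where k: "T (1 - r k) (1 - r k) > 1 - \<epsilon>" "S (r k) (r k) < \<epsilon>" "r k + r k < t"
    by (auto dest!: eventually_happens'[OF sequentially_bot])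
  obtain n0 where n0: "\<And>n. n \<ge> n0 \<Longrightarrow> \<sigma> n \<in> ifm_ball X M N (c k) (r k) (r k)"
    using ev[of k] unfolding eventually_sequentially by blast
  have "M (\<sigma> n) (\<sigma> m) t > 1 - \<epsilon> \<and> N (\<sigma> n) (\<sigma> m) t < \<epsilon>" if nm: "n \<ge> n0" "m \<ge> n0" for n m
  proof -
    have X: "\<sigma> n \<in> X" "\<sigma> m \<in> X" "c k \<in> X" using \<sigma> c by auto
    have balls: "M (\<sigma> n) (c k) (r k) > 1 - r k" "M (c k) (\<sigma> m) (r k) > 1 - r k"
      "N (\<sigma> n) (c k) (r k) < r k" "N (c k) (\<sigma> m) (r k) < r k"
      using n0[OF nm(1)] n0[OF nm(2)] M_commute[OF X(1,3) r01(1)] N_commute[OF X(1,3) r01(1)]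
      by (auto simp: ifm_ball_def)
    note range = M_range[OF X(1,3) r01(1)] M_range[OF X(3,2) r01(1)]
      N_range[OF X(1,3) r01(1)] N_range[OF X(3,2) r01(1)]
    have "T (1 - r k) (1 - r k) \<le> T (M (\<sigma> n) (c k) (r k)) (M (c k) (\<sigma> m) (r k))"
      using balls by (intro tnorm_mono range r01') auto
    also have "\<dots> \<le> M (\<sigma> n) (\<sigma> m) (r k + r k)"
      by (rule M_triangle) (use X r01 in auto)
    also have "\<dots> \<le> M (\<sigma> n) (\<sigma> m) t"
      by (rule M_mono) (use X r01[of k] k in auto)
    finally have 1: "M (\<sigma> n) (\<sigma> m) t > 1 - \<epsilon>" using k by simp
    have "N (\<sigma> n) (\<sigma> m) t \<le> N (\<sigma> n) (\<sigma> m) (r k + r k)"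
      by (rule N_antimono) (use X r01[of k] k in auto)
    also have "\<dots> \<le> S (N (\<sigma> n) (c k) (r k)) (N (c k) (\<sigma> m) (r k))"
      by (rule N_triangle) (use X r01 in auto)
    also have "\<dots> \<le> S (r k) (r k)"
      using balls by (intro tconorm_mono range r01') auto
    finally show ?thesis using 1 k by simp
  qed
  then show "\<exists>n0. \<forall>n\<ge>n0. \<forall>m\<ge>n0. M (\<sigma> n) (\<sigma> m) t > 1 - \<epsilon> \<and> N (\<sigma> n) (\<sigma> m) t < \<epsilon>"
    by blast
qed

text \<open>Once \<open>r k < t\<close>, raising the time from \<open>r k\<close> to
  \<open>t\<close> only enlarges the ball, which squeezes \<open>M (c k) y t\<close> between
  \<open>1 - r k\<close> and 1, and \<open>N (c k) y t\<close> between 0 and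
  \<open>r k\<close>.\<close>

lemma ifm_converges_if_in_shrinking_balls:
  assumes c: "range c \<subseteq> X" and y: "y \<in> X" and r: "r \<longlonglongrightarrow> 0" "\<And>k. r k \<in> {0<..<1}"
    and ball: "\<And>k. y \<in> ifm_ball X M N (c k) (r k) (r k)"
  shows "ifm_converges M N c y"
  unfolding ifm_converges_def
proof (intro allI impI)
  fix t :: real assume t: "0 < t"
  have cX: "c k \<in> X" for k using c by auto
  have "\<forall>\<^sub>F k in sequentially. r k < t"
    using order_tendstoD(2)[OF r(1) t] .
  then have ev: "\<forall>\<^sub>F k in sequentially. 1 - r k \<le> M (c k) y t \<and> N (c k) y t \<le> r k"
  proof eventually_elim
    case (elim k)
    have "y \<in> ifm_ball X M N (c k) (r k) t"
      using ifm_ball_mono[OF cX order_refl, of "r k" t k "r k"] ball[of k] r(2)[of k] elim by auto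
    then show ?case by (simp add: ifm_ball_def)
  qed
  have bound: "M (c k) y t \<le> 1" "0 \<le> N (c k) y t" for k
    using M_range[OF cX y t] N_range[OF cX y t] by auto
  show "(\<lambda>k. M (c k) y t) \<longlonglongrightarrow> 1 \<and> (\<lambda>k. N (c k) y t) \<longlonglongrightarrow> 0"
  proof
    show "(\<lambda>k. M (c k) y t) \<longlonglongrightarrow> 1"
      by (rule tendsto_sandwich[of "\<lambda>k. 1 - r k" _ _ "\<lambda>_. 1"])
        (use ev bound r(1) in \<open>auto intro!: tendsto_eq_intros elim: eventually_mono\<close>)
    show "(\<lambda>k. N (c k) y t) \<longlonglongrightarrow> 0"
      by (rule tendsto_sandwich[of "\<lambda>_. 0" _ _ r])
        (use ev bound r(1) in \<open>auto elim: eventually_mono\<close>)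
  qed
qed

end

theorem theorem3p8:
  fixes Y X :: "'a set"
    and M N :: "'a \<Rightarrow> 'a \<Rightarrow> real \<Rightarrow> real"
    and T S :: "real \<Rightarrow> real \<Rightarrow> real"
  assumes "ifm_space Y M N T S"
    and "X \<subseteq> Y"
    and "topologically_complete_ifm_metrizable (subtopology (ifm_topology Y M N) X)"
  shows "gdelta_in (ifm_topology Y M N) X"
proof -
  interpret Y: ifm_space Y M N T S by fact
  let ?\<tau> = "ifm_topology Y M N"
  have topspace: "topspace (subtopology ?\<tau> X) = X"
    using assms(2) by (auto simp: topspace_subtopology Y.topspace_ifm_topology)
  obtain M' N' T' S' where X: "ifm_space X M' N' T' S'" and complete: "ifm_complete X M' N'"
    and top: "ifm_topology X M' N' = subtopology ?\<tau> X"
    using assms(3) unfolding topologically_complete_ifm_metrizable_def topspace by blast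
  interpret X: ifm_space X M' N' T' S' by fact
  \<comment> \<open>The double successor makes \<open>r 0\<close> equal to 1/2, so every
    \<open>r k\<close> is strictly below 1. The same number serves as radius and as time.\<close>
  define r :: "nat \<Rightarrow> real" where "r k = inverse (real (Suc (Suc k)))" for k
  have r_lim: "r \<longlonglongrightarrow> 0"
    unfolding r_def using LIMSEQ_Suc[OF LIMSEQ_inverse_real_of_nat] .
  have r01: "r k \<in> {0<..<1}" for k
    by (auto simp: r_def field_simps)
  define small where "small n U x \<longleftrightarrow> openin ?\<tau> U \<and> x \<in> X \<and>
    U \<subseteq> ifm_ball Y M N x (r n) (r n) \<and> U \<inter> X \<subseteq> ifm_ball X M' N' x (r n) (r n)" for n U x
  define W where "W n = \<Union> {U. \<exists>x. small n U x}" for n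
  have "openin ?\<tau> (W n)" for n
    unfolding W_def by (rule openin_Union) (auto simp: small_def)
  moreover have "X \<subseteq> W n" for n
  proof
    fix x assume x: "x \<in> X"
    have r0: "0 < r n" using r01[of n] by auto
    \<comment> \<open>By \<open>top\<close>, a ball of the complete metric is the trace on
      \<open>X\<close> of some open \<open>V\<close>. Cutting \<open>V\<close> down by the ball of
      \<open>Y\<close> makes it small for both metrics.\<close>
    have "openin (subtopology ?\<tau> X) (ifm_ball X M' N' x (r n) (r n))"
      unfolding top[symmetric] X.openin_ifm_topology by (rule X.ifm_open_ball[OF x r0])
    then obtain V where V: "openin ?\<tau> V" "ifm_ball X M' N' x (r n) (r n) = V \<inter> X"
      by (auto simp: openin_subtopology)
    have xY: "x \<in> Y" using x assms(2) by blast
    have "small n (V \<inter> ifm_ball Y M N x (r n) (r n)) x"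
      using V x Y.ifm_open_ball[OF xY r0] by (auto simp: small_def Y.openin_ifm_topology[symmetric])
    moreover have "x \<in> V \<inter> ifm_ball Y M N x (r n) (r n)"
      using V(2) X.center_in_ifm_ball[OF x r0 r0] Y.center_in_ifm_ball[OF xY r0 r0] by blast
    ultimately show "x \<in> W n" unfolding W_def by blast
  qed
  moreover have "y \<in> X" if y: "\<And>n. y \<in> W n" for y
  proof -
    have "\<exists>U x. small n U x \<and> y \<in> U" for n
      using y[of n] unfolding W_def by blast
    then obtain U c where small: "\<And>n. small n (U n) (c n)" and yU: "\<And>n. y \<in> U n"
      by metis
    have cX: "range c \<subseteq> X" using small by (auto simp: small_def)
    then have cY: "range c \<subseteq> Y" using assms(2) by blast
    have ball: "y \<in> ifm_ball Y M N (c n) (r n) (r n)" for n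
      using small yU unfolding small_def by blast
    then have yY: "y \<in> Y" by (auto simp: ifm_ball_def)
    have conv_y: "ifm_converges M N c y"
      by (rule Y.ifm_converges_if_in_shrinking_balls[OF cY yY r_lim r01 ball])
    then have lim_y: "limitin ?\<tau> c y sequentially"
      using Y.limitin_ifm_topology_iff[OF cY yY] by blast
    \<comment> \<open>For fixed \<open>k\<close>, the set \<open>U k\<close> is a neighbourhood of
      \<open>y\<close> and so contains almost all \<open>c n\<close>. As these lie in
      \<open>X\<close>, they fall into the trace of \<open>U k\<close>, hence into the ball of the
      complete metric around \<open>c k\<close>.\<close>
    have "\<forall>\<^sub>F n in sequentially. c n \<in> ifm_ball X M' N' (c k) (r k) (r k)" for k
    proof -
      have "\<forall>\<^sub>F n in sequentially. c n \<in> U k"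
        using lim_y small[of k] yU[of k] by (auto simp: limitin_def small_def)
      then show ?thesis
        by eventually_elim (use small[of k] cX in \<open>auto simp: small_def\<close>)
    qed
    then have "ifm_Cauchy M' N' c"
      using cX by (intro X.ifm_Cauchy_if_eventually_in_balls[OF cX r_lim r01]) auto
    then obtain x where x: "x \<in> X" and "ifm_converges M' N' c x"
      using complete cX unfolding ifm_complete_def by blast
    \<comment> \<open>Equality of the two topologies on \<open>X\<close> turns convergence for
      \<open>M'\<close> and \<open>N'\<close> into convergence in \<open>Y\<close>, where
      \<open>x\<close> can be compared with \<open>y\<close>.\<close>
    then have "limitin ?\<tau> c x sequentially"
      using X.limitin_ifm_topology_iff[OF cX x] by (simp add: top limitin_subtopology)
    then have "ifm_converges M N c x"
      using Y.limitin_ifm_topology_iff[OF cY] x assms(2) by blast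
    then show "y \<in> X"
      using Y.ifm_converges_unique[OF cY _ yY _ conv_y] x assms(2) by blast
  qed
  ultimately have W: "\<And>n. openin ?\<tau> (W n)" and "X = \<Inter> (range W)"
    by auto
  \<comment> \<open>The range of a sequence is countable and nonempty, and open sets are themselves
    G-delta.\<close>
  moreover have "gdelta_in ?\<tau> (\<Inter> (range W))"
    by (rule gdelta_in_Inter) (use W in \<open>auto intro: open_imp_gdelta_in\<close>)
  ultimately show ?thesis by simp
qed

end
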